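(* Let $\mathcal{T}=(T_1,T_2,T_3)$ be a solution to Nahm's equations on a nonempty, connected, open interval, with values in $\mathfrak{su}(n)^{\oplus3}$. If $\mathcal{T}$ is spherically symmetric and the corresponding function $A\mapsto U_A$ can be chosen to be continuously differentiable at the identity of $\mathrm{SO}(3)$, then there exists a triple $Y_1,Y_2,Y_3\in\mathfrak{su}(n)$ such that for all $i,j\in\{1,2,3\}$ (at every point of the domain) $$[Y_i,T_j]=\sum_{k=1}^3\epsilon_{ijk}T_k.$$ Conversely, if these equations are satisfied for some $Y_1,Y_2,Y_3\in\mathfrak{su}(n)$, then $\mathcal{T}$ is spherically symmetric.
   Context: Nahm's equations are $\dot T_1=[T_2,T_3]$, $\dot T_2=[T_3,T_1]$, $\dot T_3=[T_1,T_2]$. For $A\in\mathrm{SO}(3)$ and $U\in\mathrm{SU}(n)$ set ${}^A\mathcal{T}=({}^AT_1,{}^AT_2,{}^AT_3)$ with ${}^AT_i:=\sum_{j=1}^3A_{ij}T_j$, and ${}_U\mathcal{T}$ with ${}_UT_i:=UT_iU^{-1}$. A solution $\mathcal{T}$ is spherically symmetric if for every $A\in\mathrm{SO}(3)$ there exists $U_A\in\mathrm{SU}(n)$ (independent of $t$) with ${}^A\mathcal{T}={}_{U_A^{-1}}\mathcal{T}$; this gives a (not necessarily unique, smooth, or homomorphic) function $\mathrm{SO}(3)\to\mathrm{SU}(n)$, $A\mapsto U_A$. $\epsilon_{ijk}$ is the Levi-Civita symbol. *)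

theory Defs
  imports "HOL-Analysis.Analysis"
begin

definition adjoint_matrix :: "complex^'n^'m \<Rightarrow> complex^'m^'n" where
  "adjoint_matrix A = (\<chi> i j. cnj (A $ j $ i))"

definition SU :: "(complex^'n^'n) set" where
  "SU = {U. adjoint_matrix U ** U = mat 1 \<and> U ** adjoint_matrix U = mat 1 \<and> det U = 1}"

definition su :: "(complex^'n^'n) set" where
  "su = {X. adjoint_matrix X = - X \<and> trace X = 0}"

definition SO3 :: "(real^3^3) set" where
  "SO3 = {A. rotation_matrix A}"

definition commutator :: "complex^'n^'n \<Rightarrow> complex^'n^'n \<Rightarrow> complex^'n^'n" where
  "commutator X Y = X ** Y - Y ** X"

definition levi_civita :: "3 \<Rightarrow> 3 \<Rightarrow> 3 \<Rightarrow> real" where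
  "levi_civita i j k =
     (if (i, j, k) \<in> {(1, 2, 3), (2, 3, 1), (3, 1, 2)} then 1
      else if (i, j, k) \<in> {(1, 3, 2), (2, 1, 3), (3, 2, 1)} then -1
      else 0)"

text \<open>A triple of matrices is an element of \<open>complex^'n^'n^3\<close>, with outermost index in
  \<open>{1, 2, 3}\<close>. A map defined on an interval \<open>I\<close> is a total function of which only the
  values on \<open>I\<close> matter.\<close>

definition nahm_solution :: "real set \<Rightarrow> (real \<Rightarrow> complex^'n^'n^3) \<Rightarrow> bool" where
  "nahm_solution I T \<longleftrightarrow>
     (\<forall>t\<in>I. (\<forall>i. T t $ i \<in> su) \<and>
       ((\<lambda>s. T s $ 1) has_vector_derivative commutator (T t $ 2) (T t $ 3)) (at t within I) \<and>
       ((\<lambda>s. T s $ 2) has_vector_derivative commutator (T t $ 3) (T t $ 1)) (at t within I) \<and>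
       ((\<lambda>s. T s $ 3) has_vector_derivative commutator (T t $ 1) (T t $ 2)) (at t within I))"

definition rotate_triple :: "real^3^3 \<Rightarrow> complex^'n^'n^3 \<Rightarrow> complex^'n^'n^3" where
  "rotate_triple A T = (\<chi> i. \<Sum>j\<in>UNIV. A $ i $ j *\<^sub>R T $ j)"

definition conj_triple :: "complex^'n^'n \<Rightarrow> complex^'n^'n^3 \<Rightarrow> complex^'n^'n^3" where
  "conj_triple U T = (\<chi> i. U ** T $ i ** matrix_inv U)"

definition compensates ::
  "real set \<Rightarrow> (real \<Rightarrow> complex^'n^'n^3) \<Rightarrow> real^3^3 \<Rightarrow> complex^'n^'n \<Rightarrow> bool" where
  "compensates I T A U \<longleftrightarrow>
     U \<in> SU \<and> (\<forall>t\<in>I. rotate_triple A (T t) = conj_triple (matrix_inv U) (T t))"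

definition spherically_symmetric :: "real set \<Rightarrow> (real \<Rightarrow> complex^'n^'n^3) \<Rightarrow> bool" where
  "spherically_symmetric I T \<longleftrightarrow> (\<forall>A\<in>SO3. \<exists>U. compensates I T A U)"

text \<open>Continuous differentiability at \<open>a\<close> of a map on an embedded submanifold \<open>S\<close>:
  differentiable near \<open>a\<close> in \<open>S\<close>, with a derivative continuous at \<open>a\<close>. The derivative within
  \<open>S\<close> is determined only on the tangent space, so \<open>D x\<close> is some linear extension of it to the
  ambient space. This costs nothing: composing the tangential derivative with the orthogonal
  projection onto the tangent space, which depends smoothly on \<open>x \<in> S\<close>, gives an extension
  that is continuous at \<open>a\<close> whenever the tangential derivative is.\<close>

definition continuously_differentiable_at_within ::
  "('a::real_normed_vector \<Rightarrow> 'b::real_normed_vector) \<Rightarrow> 'a \<Rightarrow> 'a set \<Rightarrow> bool" where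
  "continuously_differentiable_at_within f a S \<longleftrightarrow>
     (\<exists>W. \<exists>D :: 'a \<Rightarrow> 'a \<Rightarrow>\<^sub>L 'b. open W \<and> a \<in> W \<and>
       (\<forall>x\<in>W \<inter> S. (f has_derivative blinfun_apply (D x)) (at x within S)) \<and>
       continuous (at a within S) D)"

end

theory Submission
  imports Defs
begin

text \<open>Conjugation identities are used in the form \<open>U (\<Sum>\<^sub>j A\<^sub>i\<^sub>j T\<^sub>j) = T\<^sub>i U\<close>.
  If \<open>U\<close> is differentiable at the identity, differentiating this along the rotations
  about the \<open>m\<close>-th axis gives the commutator relations for the logarithmic derivative of \<open>U\<close>,
  which is skew-Hermitian; its trace-free part is \<open>Y\<^sub>m\<close>. Conversely, if \<open>E' = E Y\<^sub>m\<close> and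
  \<open>E 0 = 1\<close>, then \<open>E (\<Sum>\<^sub>j A\<^sub>i\<^sub>j T\<^sub>j) E\<^sup>*\<close> is constant along the rotations \<open>A\<close> about the
  \<open>m\<close>-th axis, so these rotations are compensated, and they generate \<open>SO3\<close>.\<close>

subsection \<open>Calculus of complex matrices\<close>

lemma bounded_bilinear_matrix_mult:
  "bounded_bilinear ((**) :: complex^'k^'m \<Rightarrow> complex^'n^'k \<Rightarrow> complex^'n^'m)"
proof -
  have "bilinear ((**) :: complex^'k^'m \<Rightarrow> complex^'n^'k \<Rightarrow> complex^'n^'m)"
    by (auto simp: bilinear_def linear_iff matrix_matrix_mult_def vec_eq_iff algebra_simps
        sum.distrib scaleR_sum_right)
  then show ?thesis
    by (simp add: bilinear_conv_bounded_bilinear)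
qed

interpretation mm: bounded_bilinear "(**) :: complex^'k^'m \<Rightarrow> complex^'n^'k \<Rightarrow> complex^'n^'m"
  by (rule bounded_bilinear_matrix_mult)

lemma has_vector_derivative_vec:
  fixes f :: "real \<Rightarrow> 'a::real_normed_vector^'n"
  assumes "\<And>i. ((\<lambda>s. f s $ i) has_vector_derivative f' $ i) (at x within S)"
  shows "(f has_vector_derivative f') (at x within S)"
  using assms unfolding has_vector_derivative_def has_derivative_def
  by (auto intro!: vec_tendstoI bounded_linear_scaleR_left)

lemma adjoint_matrix_mult: "adjoint_matrix (A ** B) = adjoint_matrix B ** adjoint_matrix A"
  by (simp add: adjoint_matrix_def matrix_matrix_mult_def vec_eq_iff mult.commute)

lemma adjoint_matrix_adjoint [simp]: "adjoint_matrix (adjoint_matrix A) = A"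
  by (simp add: adjoint_matrix_def vec_eq_iff)

lemma adjoint_matrix_mat: "adjoint_matrix (mat c) = mat (cnj c)"
  by (auto simp: adjoint_matrix_def vec_eq_iff mat_def)

lemma adjoint_matrix_diff: "adjoint_matrix (A - B) = adjoint_matrix A - adjoint_matrix B"
  by (simp add: adjoint_matrix_def vec_eq_iff)

lemma bounded_linear_adjoint_matrix:
  "bounded_linear (adjoint_matrix :: complex^'n^'m \<Rightarrow> complex^'m^'n)"
  by (simp add: linear_conv_bounded_linear [symmetric] linear_iff adjoint_matrix_def vec_eq_iff)

lemma det_adjoint_matrix: "det (adjoint_matrix A) = cnj (det A)"
proof -
  have "det (adjoint_matrix A) = det (transpose (adjoint_matrix A))"
    by (simp add: det_transpose)
  also have "\<dots> = cnj (det A)"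
    by (simp add: det_def adjoint_matrix_def transpose_def)
  finally show ?thesis .
qed

lemma mat_mult_left: "mat c ** A = (\<chi> i j. c * A $ i $ j)" for A :: "'a::semiring_1^'m^'n"
  by (simp add: matrix_matrix_mult_def mat_def vec_eq_iff if_distrib [of "\<lambda>x. x * _"] cong: if_cong)

lemma mat_mult_right: "A ** mat c = (\<chi> i j. A $ i $ j * c)" for A :: "'a::semiring_1^'m^'n"
  by (simp add: matrix_matrix_mult_def mat_def vec_eq_iff if_distrib [of "(*) _"] cong: if_cong)

lemma mat_mult_commute: "mat c ** A = A ** mat c" for A :: "'a::comm_semiring_1^'n^'n"
  by (simp add: mat_mult_left mat_mult_right mult.commute)

lemma mat_mult_mat: "mat c ** mat d = (mat (c * d) :: 'a::semiring_1^'n^'n)"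
  by (auto simp: mat_mult_left) (auto simp: mat_def vec_eq_iff)

lemma det_mat: "det (mat c :: 'a::comm_ring_1^'n^'n) = c ^ CARD('n)"
  by (subst det_diagonal) (auto simp: mat_def)

text \<open>A unitary matrix can be scaled by a unit complex number to have determinant 1; this spares
  computing the determinant of an exponential.\<close>

lemma unitary_rescale_SU:
  fixes U :: "complex^'n^'n"
  assumes "adjoint_matrix U ** U = mat 1"
  obtains c where "mat c ** U \<in> SU"
proof -
  have U': "U ** adjoint_matrix U = mat 1"
    using assms by (simp add: matrix_left_right_inverse)
  have d: "cnj (det U) * det U = 1"
    using arg_cong [OF assms, of det] by (simp add: det_mul det_adjoint_matrix)
  \<comment> \<open>Scaling by \<open>c\<close> multiplies the determinant by
    \<open>c ^ CARD('n)\<close>, so this root yields \<open>cnj (det U) * det U = 1\<close>; its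
    norm is 1 because that of \<open>det U\<close> is.\<close>
  obtain c where c: "c ^ CARD('n) = cnj (det U)"
    by (metis exists_complex_root zero_less_card_finite neq0_conv)
  have "norm (det U) ^ 2 = 1"
    using arg_cong [OF d, of norm] by (simp add: norm_mult power2_eq_square)
  then have "norm (det U) = 1"
    by (simp add: power2_eq_1_iff) (smt (verit) norm_ge_zero)
  then have "norm c ^ CARD('n) = 1"
    using arg_cong [OF c, of norm] by (simp add: norm_power)
  then have nc: "norm c = 1"
    using power_eq_1_iff [of "norm c" "CARD('n)"] by simp
  then have cc: "cnj c * c = 1" "c * cnj c = 1"
    by (simp_all add: complex_norm_square [symmetric] mult.commute)
  let ?V = "mat c ** U"
  have "adjoint_matrix ?V ** ?V = adjoint_matrix U ** (mat (cnj c) ** mat c) ** U"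
    by (simp add: adjoint_matrix_mult adjoint_matrix_mat matrix_mul_assoc)
  then have "adjoint_matrix ?V ** ?V = mat 1"
    using assms by (simp add: mat_mult_mat cc)
  moreover have "det ?V = 1"
    using c d by (simp add: det_mul det_mat)
  ultimately have "?V \<in> SU"
    by (simp add: SU_def matrix_left_right_inverse [of "adjoint_matrix ?V"])
  then show ?thesis by (rule that)
qed

subsection \<open>One-parameter groups of matrices\<close>

text \<open>The new factor stands on the right, so that the exponential series directly satisfies
  \<open>E' = E A\<close>.\<close>

primrec matrix_pow :: "'a::semiring_1^'n^'n \<Rightarrow> nat \<Rightarrow> 'a^'n^'n" where
  "matrix_pow A 0 = mat 1"
| "matrix_pow A (Suc k) = matrix_pow A k ** A"

text \<open>The geometric bound lets a scalar exponential series dominate every entry of the matrix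
  exponential. In the base, the factor \<open>CARD('n)\<close> absorbs the inner sum of a matrix
  product.\<close>

lemma norm_matrix_pow_nth_le:
  fixes A :: "complex^'n^'n"
  obtains c where "\<And>k i j. norm (matrix_pow A k $ i $ j) \<le> c ^ k"
proof -
  define b where "b = (\<Sum>i\<in>UNIV. \<Sum>j\<in>UNIV. norm (A $ i $ j))"
  have b0: "b \<ge> 0"
    unfolding b_def by (intro sum_nonneg) auto
  have b: "norm (A $ i $ j) \<le> b" for i j
  proof -
    have "norm (A $ i $ j) \<le> (\<Sum>j\<in>UNIV. norm (A $ i $ j))"
      by (rule member_le_sum) auto
    also have "\<dots> \<le> b"
      unfolding b_def by (rule member_le_sum) (auto intro: sum_nonneg)
    finally show ?thesis .
  qed
  have "norm (matrix_pow A k $ i $ j) \<le> (CARD('n) * b) ^ k" for k i j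
  proof (induction k arbitrary: i j)
    case 0
    show ?case by (simp add: mat_def)
  next
    case (Suc k)
    have "norm (matrix_pow A (Suc k) $ i $ j)
        \<le> (\<Sum>l\<in>UNIV. norm (matrix_pow A k $ i $ l * A $ l $ j))"
      unfolding matrix_pow.simps matrix_matrix_mult_def by (simp add: sum_norm_le norm_mult)
    also have "\<dots> \<le> (\<Sum>l\<in>(UNIV :: 'n set). (CARD('n) * b) ^ k * b)"
      unfolding norm_mult using b0 by (intro sum_mono mult_mono Suc.IH b) auto
    finally show ?case by (simp add: mult_ac)
  qed
  then show ?thesis by (rule that)
qed

text \<open>\<open>E s\<close> is the exponential of \<open>s A\<close>, built entry by entry from
  complex power series and then restricted to real arguments.\<close>

lemma matrix_one_parameter_group:
  fixes A :: "complex^'n^'n"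
  obtains E :: "real \<Rightarrow> complex^'n^'n"
  where "E 0 = mat 1" "\<And>s. (E has_vector_derivative E s ** A) (at s)"
proof -
  obtain b where b: "norm (matrix_pow A k $ i $ j) \<le> b ^ k" for k i j
    using norm_matrix_pow_nth_le by blast
  define c where "c i j k = matrix_pow A k $ i $ j / fact k" for i j k
  have summable: "summable (\<lambda>k. c i j k * z ^ k)" for i j and z :: complex
  proof (rule summable_comparison_test')
    show "summable (\<lambda>k. inverse (fact k) * (b * norm z) ^ k)"
      by (rule summable_exp)
    show "norm (c i j k * z ^ k) \<le> inverse (fact k) * (b * norm z) ^ k" for k
      using mult_right_mono [OF b [of k i j], of "norm z ^ k / fact k"]
      by (simp add: c_def norm_mult norm_divide norm_power power_mult_distrib field_simps)
  qed
  \<comment> \<open>Termwise differentiation turns A^(k+1)/(k+1)! into (A^k/k!) A, whose entries are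
    the coefficients of the series for \<open>E A\<close>.\<close>
  have diffs: "diffs (c i j) k = (\<Sum>l\<in>UNIV. c i l k * A $ l $ j)" for i j k
    by (simp add: diffs_def c_def matrix_matrix_mult_def sum_divide_distrib [symmetric]
        field_simps del: of_nat_Suc)
  define F where "F i j z = (\<Sum>k. c i j k * z ^ k)" for i j z
  have "(\<Sum>k. diffs (c i j) k * z ^ k) = (\<Sum>l\<in>UNIV. F i l z * A $ l $ j)" for i j z
  proof -
    have "(\<Sum>k. diffs (c i j) k * z ^ k) = (\<Sum>k. \<Sum>l\<in>UNIV. c i l k * z ^ k * A $ l $ j)"
      by (simp only: diffs sum_distrib_right) (simp only: mult_ac)
    also have "\<dots> = (\<Sum>l\<in>UNIV. \<Sum>k. c i l k * z ^ k * A $ l $ j)"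
      by (rule suminf_sum) (intro summable_mult2 summable)
    finally show ?thesis
      by (simp add: F_def suminf_mult2 [OF summable])
  qed
  then have F: "(F i j has_field_derivative (\<Sum>l\<in>UNIV. F i l z * A $ l $ j)) (at z)" for i j z
    using termdiffs_strong_converges_everywhere [OF summable, of i j z]
    by (simp add: F_def [abs_def])
  define E where "E s = (\<chi> i j. F i j (of_real s))" for s :: real
  have "F i j 0 = c i j 0" for i j
    unfolding F_def by (rule powser_zero)
  then have "E 0 = mat 1"
    by (simp add: E_def c_def vec_eq_iff mat_def)
  moreover have "(E has_vector_derivative E s ** A) (at s)" for s
    by (intro has_vector_derivative_vec)
      (simp add: E_def matrix_matrix_mult_def has_vector_derivative_real_field [OF F])
  ultimately show ?thesis by (rule that)
qed

text \<open>By skewness the two terms in the derivative of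
  \<open>E s ** adjoint_matrix (E s)\<close> cancel, so this product keeps its value at 0.\<close>

lemma one_parameter_group_unitary:
  fixes Y :: "complex^'n^'n"
  assumes "adjoint_matrix Y = - Y" "E 0 = mat 1"
    and E: "\<And>s. (E has_vector_derivative E s ** Y) (at s)"
  shows "E s ** adjoint_matrix (E s) = mat 1" "adjoint_matrix (E s) ** E s = mat 1"
proof -
  have E': "((\<lambda>s. adjoint_matrix (E s)) has_vector_derivative - (Y ** adjoint_matrix (E s))) (at s)"
    for s
    using bounded_linear.has_vector_derivative [OF bounded_linear_adjoint_matrix E, of s]
    by (simp add: adjoint_matrix_mult assms(1) mm.minus_left)
  have "((\<lambda>s. E s ** adjoint_matrix (E s)) has_vector_derivative 0) (at s)" for s
    using mm.has_vector_derivative [OF E E', of s]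
    by (simp add: mm.minus_right matrix_mul_assoc)
  then obtain C where C: "E s ** adjoint_matrix (E s) = C" for s
    using has_vector_derivative_zero_constant [of UNIV "\<lambda>s. E s ** adjoint_matrix (E s)"] by auto
  then have "C = mat 1"
    using C [of 0] assms(2) by (simp add: adjoint_matrix_mat)
  with C show "E s ** adjoint_matrix (E s) = mat 1" by simp
  then show "adjoint_matrix (E s) ** E s = mat 1"
    by (simp add: matrix_left_right_inverse)
qed

subsection \<open>Rotations about the coordinate axes\<close>

text \<open>One formula covers the three right-handed rotations: off the diagonal the symbol
  vanishes in row and column \<open>m\<close>, and elsewhere it supplies the sign of the
  sine.\<close>

definition axis_rotation :: "3 \<Rightarrow> real \<Rightarrow> real^3^3" where
  "axis_rotation m s =
     (\<chi> i j. if i = j then if i = m then 1 else cos s else - levi_civita m i j * sin s)"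

text \<open>The derivative of \<open>axis_rotation m\<close> at 0, that is, the matrix of the cross
  product with the \<open>m\<close>-th unit vector from the left.\<close>

definition axis_generator :: "3 \<Rightarrow> real^3^3" where
  "axis_generator m = (\<chi> i j. - levi_civita m i j)"

lemma axis_rotation_0: "axis_rotation m 0 = mat 1"
  by (simp add: axis_rotation_def mat_def vec_eq_iff)

lemma axis_rotation_in_SO3: "axis_rotation m s \<in> SO3"
proof -
  \<comment> \<open>Quantifying over \<open>m\<close> lets \<open>forall_3\<close> split the claim
    into three concrete matrices.\<close>
  have "\<forall>m. axis_rotation m s \<in> SO3"
    using sin_cos_squared_add [of s]
    by (simp add: forall_3 SO3_def rotation_matrix_def orthogonal_matrix det_3 vec_eq_iff
        transpose_def matrix_matrix_mult_def mat_def sum_3 axis_rotation_def levi_civita_def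
        power2_eq_square add.commute)
  then show ?thesis by blast
qed

lemma axis_rotation_minus: "axis_rotation m (- s) ** axis_rotation m s = mat 1"
proof -
  have "axis_rotation m (- s) = transpose (axis_rotation m s)"
    using exhaust_3 [of m]
    by (auto simp: vec_eq_iff forall_3 transpose_def axis_rotation_def levi_civita_def)
  then show ?thesis
    using axis_rotation_in_SO3 [of m s]
    by (simp add: SO3_def rotation_matrix_def orthogonal_matrix)
qed

lemma axis_rotation_has_derivative:
  "((\<lambda>s. axis_rotation m s $ i $ j) has_real_derivative
     (axis_rotation m s ** axis_generator m) $ i $ j) (at s)"
proof -
  have "\<forall>m i j. ((\<lambda>s. axis_rotation m s $ i $ j) has_real_derivative
     (axis_rotation m s ** axis_generator m) $ i $ j) (at s)"
    unfolding forall_3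
    by (auto simp: axis_rotation_def axis_generator_def matrix_matrix_mult_def sum_3
        levi_civita_def intro!: derivative_eq_intros)
  then show ?thesis by blast
qed

lemma SO3_mult: "A \<in> SO3 \<Longrightarrow> B \<in> SO3 \<Longrightarrow> A ** B \<in> SO3"
  by (auto simp: SO3_def rotation_matrix_def det_mul orthogonal_matrix_mul)

lemma exists_polar:
  fixes x y :: real
  obtains r \<theta> where "r \<ge> 0" "x = r * cos \<theta>" "y = r * sin \<theta>"
proof
  show "x = cmod (Complex x y) * cos (Arg (Complex x y))"
    by (metis Re_rcis complex.sel(1) rcis_cmod_Arg)
  show "y = cmod (Complex x y) * sin (Arg (Complex x y))"
    by (metis Im_rcis complex.sel(2) rcis_cmod_Arg)
qed simp

text \<open>Two Givens rotations clear the first column of \<open>A\<close> below the diagonal; orthogonality then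
  leaves a rotation about the first axis.\<close>

lemma SO3_axis_rotation_product:
  assumes "A \<in> SO3"
  obtains a b c where "A = axis_rotation 3 a ** (axis_rotation 2 b ** axis_rotation 1 c)"
proof -
  obtain r \<alpha> where r: "A$1$1 = r * cos \<alpha>" "A$2$1 = r * sin \<alpha>"
    by (rule exists_polar)
  define B where "B = axis_rotation 3 (- \<alpha>) ** A"
  have B: "B \<in> SO3" "B$2$1 = 0"
    using assms r by (auto simp: B_def intro!: SO3_mult axis_rotation_in_SO3)
      (simp add: matrix_matrix_mult_def sum_3 axis_rotation_def levi_civita_def)
  obtain q \<beta> where q: "q \<ge> 0" "B$1$1 = q * cos \<beta>" "B$3$1 = q * sin \<beta>"
    by (rule exists_polar)
  \<comment> \<open>The sign of the angle is opposite to that of the first step, since a positive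
    rotation about the second axis turns the third axis towards the first.\<close>
  define C where "C = axis_rotation 2 \<beta> ** B"
  have "C \<in> SO3"
    using B by (simp add: C_def SO3_mult axis_rotation_in_SO3)
  have "C$1$1 = q * cos \<beta> * cos \<beta> + q * sin \<beta> * sin \<beta>" and C: "C$2$1 = 0" "C$3$1 = 0"
    using q B by (simp_all add: C_def matrix_matrix_mult_def sum_3 axis_rotation_def
        levi_civita_def)
  then have "C$1$1 \<ge> 0"
    using q(1) by (simp add: mult.assoc)
  have col: "(\<Sum>i\<in>UNIV. C$i$j * C$i$k) = (if j = k then 1 else 0)" for j k
    using \<open>C \<in> SO3\<close>
    by (auto simp: SO3_def rotation_matrix_def orthogonal_matrix vec_eq_iff
        matrix_matrix_mult_def transpose_def mat_def)
  \<comment> \<open>The first column is a unit vector with only one nonzero entry; the choice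
    \<open>q \<ge> 0\<close> excludes the value -1.\<close>
  have C11: "C$1$1 = 1"
    using col [of 1 1] \<open>C$1$1 \<ge> 0\<close> C
    by (simp add: sum_3) (metis abs_of_nonneg abs_square_eq_1 power2_eq_square)
  have C1: "C$1$2 = 0" "C$1$3 = 0"
    using col [of 1 2] col [of 1 3] C C11 by (simp_all add: sum_3)
  have sq: "C$2$2 * C$2$2 + C$3$2 * C$3$2 = 1" "C$2$2 * C$2$3 + C$3$2 * C$3$3 = 0"
    "C$2$3 * C$2$3 + C$3$3 * C$3$3 = 1"
    using col [of 2 2] col [of 2 3] col [of 3 3] C1 by (simp_all add: sum_3)
  have "det C = 1"
    using \<open>C \<in> SO3\<close> by (simp add: SO3_def rotation_matrix_def)
  then have det: "C$2$2 * C$3$3 - C$2$3 * C$3$2 = 1"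
    using C C1 C11 by (simp add: det_3)
  \<comment> \<open>Expanded, the left side is the sum of the squared lengths of two unit columns
    minus twice the determinant: 1 + 1 - 2.\<close>
  have "(C$2$2 - C$3$3)\<^sup>2 + (C$2$3 + C$3$2)\<^sup>2 = 0"
    using sq det by (simp add: power2_eq_square algebra_simps)
  then have D: "C$3$3 = C$2$2" "C$2$3 = - C$3$2"
    by (auto simp: sum_power2_eq_zero_iff)
  obtain \<gamma> where "C$2$2 = cos \<gamma>" "C$3$2 = sin \<gamma>"
    using sq(1) sincos_total_2pi [of "C$2$2" "C$3$2"] by (metis power2_eq_square)
  then have "C = axis_rotation 1 \<gamma>"
    using C C1 C11 D by (simp add: vec_eq_iff forall_3 axis_rotation_def levi_civita_def)
  moreover have "A = axis_rotation 3 \<alpha> ** (axis_rotation 2 (- \<beta>) ** C)"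
    using axis_rotation_minus [of 3 "- \<alpha>"] axis_rotation_minus [of 2 \<beta>]
    by (simp add: B_def C_def matrix_mul_assoc)
  ultimately show ?thesis using that by blast
qed

subsection \<open>Compensating matrices\<close>

lemma SU_unitary:
  assumes "U \<in> SU"
  shows "adjoint_matrix U ** U = mat 1" "U ** adjoint_matrix U = mat 1"
  using assms by (auto simp: SU_def)

lemma matrix_inv_eq:
  assumes "V ** U = mat 1" "U ** V = mat 1"
  shows "matrix_inv U = V"
proof -
  have "U ** matrix_inv U = mat 1 \<and> matrix_inv U ** U = mat 1"
    unfolding matrix_inv_def by (rule someI) (use assms in blast)
  then show ?thesis
    using assms by (metis matrix_mul_assoc matrix_mul_lid matrix_mul_rid)
qed

lemma SU_mult:
  assumes "U \<in> SU" "V \<in> SU"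
  shows "U ** V \<in> SU"
proof -
  have "adjoint_matrix V ** (adjoint_matrix U ** U) ** V = mat 1"
    using assms by (simp add: SU_unitary)
  then have "adjoint_matrix (U ** V) ** (U ** V) = mat 1"
    by (simp add: adjoint_matrix_mult matrix_mul_assoc)
  then show ?thesis
    using assms by (simp add: SU_def det_mul matrix_left_right_inverse [of _ "U ** V"])
qed

text \<open>Clearing the inverses makes the condition linear in \<open>U\<close>, ready for
  differentiation and for scaling.\<close>

lemma compensates_iff:
  "compensates I T A U \<longleftrightarrow>
     U \<in> SU \<and> (\<forall>t\<in>I. \<forall>i. U ** rotate_triple A (T t) $ i = T t $ i ** U)"
proof (cases "U \<in> SU")
  case True
  note U = SU_unitary [OF True]
  have inv: "matrix_inv U = adjoint_matrix U" "matrix_inv (adjoint_matrix U) = U"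
    using U by (simp_all add: matrix_inv_eq)
  have "P = adjoint_matrix U ** X ** U \<longleftrightarrow> U ** P = X ** U" for P X
  proof
    assume "P = adjoint_matrix U ** X ** U"
    then have "U ** P = U ** adjoint_matrix U ** X ** U"
      by (simp add: matrix_mul_assoc)
    then show "U ** P = X ** U"
      by (simp add: U)
  next
    assume "U ** P = X ** U"
    then have "adjoint_matrix U ** U ** P = adjoint_matrix U ** X ** U"
      by (simp add: matrix_mul_assoc [symmetric])
    then show "P = adjoint_matrix U ** X ** U"
      by (simp add: U)
  qed
  then show ?thesis
    using True by (simp add: compensates_def conj_triple_def inv vec_eq_iff [where 'b = 3])
qed (simp add: compensates_def)

lemma rotate_triple_mult: "rotate_triple (A ** B) X = rotate_triple A (rotate_triple B X)"
proof -
  have "rotate_triple (A ** B) X $ i = rotate_triple A (rotate_triple B X) $ i" for i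
    unfolding rotate_triple_def matrix_matrix_mult_def vec_lambda_beta scaleR_sum_left
      scaleR_sum_right scaleR_scaleR by (rule sum.swap)
  then show ?thesis by (simp add: vec_eq_iff)
qed

lemma rotate_triple_mat_1 [simp]: "rotate_triple (mat 1) X = X"
  by (simp add: rotate_triple_def mat_def vec_eq_iff if_distrib [of "\<lambda>x. x *\<^sub>R _"] cong: if_cong)

text \<open>This reduces spherical symmetry to a generating set of rotations.\<close>

lemma compensates_mult:
  assumes "compensates I T A U" "compensates I T B V"
  shows "compensates I T (A ** B) (U ** V)"
proof -
  have "U ** V ** rotate_triple (A ** B) (T t) $ i = T t $ i ** (U ** V)" if "t \<in> I" for t i
  proof -
    have B: "V ** rotate_triple B (T t) $ j = T t $ j ** V" for j
      using assms(2) that by (simp add: compensates_iff)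
    have A: "U ** rotate_triple A (T t) $ i = T t $ i ** U"
      using assms(1) that by (simp add: compensates_iff)
    \<comment> \<open>The entries of \<open>A\<close> are real scalars, so \<open>V\<close> passes
      through the outer combination and acts on each component rotated by \<open>B\<close>.\<close>
    have "V ** rotate_triple (A ** B) (T t) $ i = rotate_triple A (T t) $ i ** V"
      unfolding rotate_triple_mult
      by (simp add: rotate_triple_def [of A] mm.sum_left mm.sum_right mm.scaleR_left
          mm.scaleR_right B)
    then have "U ** V ** rotate_triple (A ** B) (T t) $ i = U ** rotate_triple A (T t) $ i ** V"
      by (simp add: matrix_mul_assoc [symmetric])
    then show ?thesis
      by (simp add: A matrix_mul_assoc)
  qed
  then show ?thesis
    using assms by (simp add: compensates_iff SU_mult)
qed

text \<open>The generator is applied innermost, so that a commutator relation for \<open>X\<close>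
  can be inserted before rotating.\<close>

lemma rotate_triple_axis_rotation_derivative:
  "((\<lambda>s. rotate_triple (axis_rotation m s) X $ i) has_vector_derivative
     rotate_triple (axis_rotation m s) (rotate_triple (axis_generator m) X) $ i) (at s)"
  unfolding rotate_triple_mult [symmetric]
  by (auto simp: rotate_triple_def intro!: derivative_eq_intros axis_rotation_has_derivative)

lemma rotate_triple_axis_generator:
  "rotate_triple (axis_generator m) X $ i = - (\<Sum>k\<in>UNIV. levi_civita m i k *\<^sub>R X $ k)"
  by (simp add: rotate_triple_def axis_generator_def sum_negf)

lemma axis_rotation_compensated:
  fixes T :: "real \<Rightarrow> complex^'n^'n^3"
  assumes Y: "Y \<in> su"
    and comm: "\<And>t j. t \<in> I \<Longrightarrow>
      commutator Y (T t $ j) = (\<Sum>k\<in>UNIV. levi_civita m j k *\<^sub>R T t $ k)"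
  obtains U where "compensates I T (axis_rotation m s) U"
proof -
  have skew: "adjoint_matrix Y = - Y"
    using Y by (simp add: su_def)
  obtain E where E0: "E 0 = mat 1" and E: "\<And>s. (E has_vector_derivative E s ** Y) (at s)"
    using matrix_one_parameter_group by blast
  note unitary = one_parameter_group_unitary [OF skew E0 E]
  have E': "((\<lambda>s. adjoint_matrix (E s)) has_vector_derivative - (Y ** adjoint_matrix (E s))) (at s)"
    for s
    using bounded_linear.has_vector_derivative [OF bounded_linear_adjoint_matrix E, of s]
    by (simp add: adjoint_matrix_mult skew mm.minus_left)
  have "E s ** rotate_triple (axis_rotation m s) (T t) $ i = T t $ i ** E s" if t: "t \<in> I" for t i
  proof -
    define P where "P s = rotate_triple (axis_rotation m s) (T t) $ i" for s
    \<comment> \<open>The infinitesimal rotation acts on the triple as minus the commutator with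
      \<open>Y\<close>. Real linear combinations inherit this, which gives the equation for
      \<open>P\<close>.\<close>
    have "rotate_triple (axis_generator m) (T t) $ j = T t $ j ** Y - Y ** T t $ j" for j
      using comm [OF t, of j, symmetric] by (simp add: rotate_triple_axis_generator commutator_def)
    then have "rotate_triple (axis_rotation m s) (rotate_triple (axis_generator m) (T t)) $ i
        = P s ** Y - Y ** P s" for s
      by (simp add: P_def rotate_triple_def [of "axis_rotation m s"] mm.sum_left mm.sum_right
          mm.scaleR_left mm.scaleR_right scaleR_diff_right sum_subtractf)
    then have P: "(P has_vector_derivative P s ** Y - Y ** P s) (at s)" for s
      using rotate_triple_axis_rotation_derivative [of m "T t" i s] by (simp add: P_def [abs_def])
    \<comment> \<open>The terms \<open>E Y P\<close> and \<open>- E P Y\<close> from the outer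
      factors cancel against \<open>E (P Y - Y P)\<close>, each multiplied by the adjoint of
      \<open>E\<close>.\<close>
    have "((\<lambda>s. E s ** P s ** adjoint_matrix (E s)) has_vector_derivative 0) (at s)" for s
      using mm.has_vector_derivative [OF mm.has_vector_derivative [OF E P] E', of s]
      by (simp add: mm.add_left mm.diff_left mm.diff_right mm.minus_right matrix_mul_assoc)
    then obtain C where "E s ** P s ** adjoint_matrix (E s) = C" for s
      using has_vector_derivative_zero_constant
        [of UNIV "\<lambda>s. E s ** P s ** adjoint_matrix (E s)"] by auto
    then have "E s ** P s ** adjoint_matrix (E s) = E 0 ** P 0 ** adjoint_matrix (E 0)"
      by simp
    also have "\<dots> = T t $ i"
      by (simp add: E0 P_def axis_rotation_0 adjoint_matrix_mat)
    finally have "E s ** P s ** (adjoint_matrix (E s) ** E s) = T t $ i ** E s"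
      by (simp add: matrix_mul_assoc)
    then show ?thesis
      by (simp add: P_def unitary)
  qed
  \<comment> \<open>Scalar matrices are central, so the identity survives the rescaling that brings
    \<open>E s\<close> into \<open>SU\<close>.\<close>
  then have comp: "mat c ** E s ** rotate_triple (axis_rotation m s) (T t) $ i
      = T t $ i ** (mat c ** E s)" if "t \<in> I" for c t i
    using that by (simp add: matrix_mul_assoc [symmetric])
      (simp add: matrix_mul_assoc mat_mult_commute [of c "T t $ i"])
  obtain c where "mat c ** E s \<in> SU"
    using unitary_rescale_SU [OF unitary(2)] by blast
  with comp have "compensates I T (axis_rotation m s) (mat c ** E s)"
    by (simp add: compensates_iff)
  then show ?thesis by (rule that)
qed

lemma spherically_symmetric_if_commutators:
  fixes T :: "real \<Rightarrow> complex^'n^'n^3" and Y :: "complex^'n^'n^3"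
  assumes "\<And>i. Y $ i \<in> su"
    and "\<And>t i j. t \<in> I \<Longrightarrow>
      commutator (Y $ i) (T t $ j) = (\<Sum>k\<in>UNIV. levi_civita i j k *\<^sub>R T t $ k)"
  shows "spherically_symmetric I T"
proof -
  have axis: "\<exists>U. compensates I T (axis_rotation m s) U" for m s
    by (rule axis_rotation_compensated [OF assms(1) assms(2)]) auto
  have mult: "\<exists>U. compensates I T (A ** B) U"
    if "\<exists>U. compensates I T A U" "\<exists>U. compensates I T B U" for A B
    using that compensates_mult by blast
  have "\<exists>U. compensates I T A U" if "A \<in> SO3" for A
    by (rule SO3_axis_rotation_product [OF that]) (simp only: mult axis)
  then show ?thesis
    by (simp add: spherically_symmetric_def)
qed

subsection \<open>Differentiating the compensating matrices\<close>

text \<open>Differentiate the unitarity relation at 0, where \<open>V\<close> is the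
  identity.\<close>

lemma skew_if_unitary_curve:
  assumes V: "(V has_vector_derivative X) (at 0)" and "V 0 = mat 1"
    and "\<And>s. adjoint_matrix (V s) ** V s = mat 1"
  shows "adjoint_matrix X = - X"
proof -
  have "((\<lambda>s. adjoint_matrix (V s) ** V s) has_vector_derivative X + adjoint_matrix X) (at 0)"
    using mm.has_vector_derivative
      [OF bounded_linear.has_vector_derivative [OF bounded_linear_adjoint_matrix V] V]
    by (simp add: assms(2) adjoint_matrix_mat)
  moreover have "((\<lambda>s. adjoint_matrix (V s) ** V s) has_vector_derivative 0) (at 0)"
    by (simp add: assms(3))
  ultimately have "X + adjoint_matrix X = 0"
    by (rule vector_derivative_unique_at)
  then show ?thesis
    by (simp add: eq_neg_iff_add_eq_0 add.commute)
qed

text \<open>Subtracting a scalar matrix changes no commutator, so that the determinant of the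
  compensating matrices need not be differentiated.\<close>

lemma skew_minus_trace_in_su:
  fixes X :: "complex^'n^'n"
  assumes "adjoint_matrix X = - X"
  shows "X - mat (trace X / CARD('n)) \<in> su"
proof -
  have "cnj (trace X) = trace (adjoint_matrix X)"
    by (simp add: trace_def adjoint_matrix_def)
  also have "\<dots> = - trace X"
    by (simp add: assms trace_def sum_negf)
  finally have "adjoint_matrix (mat (trace X / CARD('n)) :: complex^'n^'n)
      = - mat (trace X / CARD('n))"
    by (simp add: adjoint_matrix_mat) (simp add: mat_def vec_eq_iff)
  moreover have "trace (mat (trace X / CARD('n)) :: complex^'n^'n) = trace X"
    by (simp add: trace_def mat_def)
  ultimately show ?thesis
    using assms by (simp add: su_def adjoint_matrix_diff trace_sub)
qed

lemma commutator_minus_mat: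
  fixes X :: "complex^'n^'n"
  shows "commutator (X - mat c) Z = commutator X Z"
  by (simp add: commutator_def mm.diff_left mm.diff_right mat_mult_commute)

text \<open>One \<open>Y\<close> serves all \<open>t\<close>, because the compensating matrices are
  independent of \<open>t\<close>.\<close>

lemma commutator_if_differentiable:
  fixes T :: "real \<Rightarrow> complex^'n^'n^3"
  assumes U: "\<And>A. A \<in> SO3 \<Longrightarrow> compensates I T A (U A)"
    and D: "(U has_derivative D) (at (mat 1) within SO3)"
  obtains Y where "Y \<in> su" "\<And>t i. t \<in> I \<Longrightarrow>
    commutator Y (T t $ i) = (\<Sum>k\<in>UNIV. levi_civita m i k *\<^sub>R T t $ k)"
proof -
  define U0 where "U0 = U (mat 1)"
  have U0: "compensates I T (mat 1) U0"
    using U [of "axis_rotation m 0"] axis_rotation_in_SO3 [of m 0]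
    by (simp add: U0_def axis_rotation_0)
  then have U0_unitary: "adjoint_matrix U0 ** U0 = mat 1" "U0 ** adjoint_matrix U0 = mat 1"
    by (simp_all add: compensates_iff SU_unitary)
  \<comment> \<open>\<open>U (mat 1)\<close> may differ from the identity matrix; dividing it out
    makes the curve start at the identity, so that its velocity is skew-Hermitian.\<close>
  define V where "V s = adjoint_matrix U0 ** U (axis_rotation m s)" for s
  have "(axis_rotation m has_vector_derivative axis_rotation m 0 ** axis_generator m) (at 0)"
    by (intro has_vector_derivative_vec)
      (simp add: has_real_derivative_iff_has_vector_derivative [symmetric]
        axis_rotation_has_derivative)
  moreover have "(U has_derivative D) (at (axis_rotation m 0) within range (axis_rotation m))"
    using D unfolding axis_rotation_0
    by (rule has_derivative_subset) (use axis_rotation_in_SO3 in auto)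
  ultimately have "((\<lambda>s. U (axis_rotation m s)) has_vector_derivative
      D (axis_rotation m 0 ** axis_generator m)) (at 0)"
    using vector_derivative_diff_chain_within [of "axis_rotation m" _ 0 UNIV U D]
    by (simp add: o_def)
  then obtain X where V: "(V has_vector_derivative X) (at 0)"
    unfolding V_def using bounded_linear.has_vector_derivative [OF mm.bounded_linear_right] by blast
  have V0: "V 0 = mat 1"
    by (simp add: V_def axis_rotation_0 U0_def [symmetric] U0_unitary)
  have "adjoint_matrix (V s) ** V s = mat 1" for s
  proof -
    let ?U = "U (axis_rotation m s)"
    have "adjoint_matrix (V s) ** V s = adjoint_matrix ?U ** (U0 ** adjoint_matrix U0) ** ?U"
      by (simp add: V_def adjoint_matrix_mult matrix_mul_assoc)
    then show ?thesis
      using U [OF axis_rotation_in_SO3] by (simp add: U0_unitary compensates_iff SU_unitary)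
  qed
  with V V0 have skew: "adjoint_matrix X = - X"
    by (rule skew_if_unitary_curve)
  have "commutator X (T t $ i) = (\<Sum>k\<in>UNIV. levi_civita m i k *\<^sub>R T t $ k)" if t: "t \<in> I" for t i
  proof -
    define P where "P s = rotate_triple (axis_rotation m s) (T t) $ i" for s
    have P: "(P has_vector_derivative rotate_triple (axis_generator m) (T t) $ i) (at 0)"
      using rotate_triple_axis_rotation_derivative [of m "T t" i 0]
      by (simp add: P_def [abs_def] axis_rotation_0)
    \<comment> \<open>Compensating the trivial rotation means commuting with every
      \<open>T t $ i\<close>. The inverse \<open>adjoint_matrix U0\<close> then commutes too, so the
      normalised \<open>V\<close> still satisfies the intertwining identity.\<close>
    have "U0 ** T t $ i = T t $ i ** U0"
      using U0 t by (simp add: compensates_iff)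
    then have "adjoint_matrix U0 ** (U0 ** T t $ i) ** adjoint_matrix U0
        = adjoint_matrix U0 ** (T t $ i ** U0) ** adjoint_matrix U0"
      by simp
    then have "adjoint_matrix U0 ** U0 ** (T t $ i ** adjoint_matrix U0)
        = adjoint_matrix U0 ** T t $ i ** (U0 ** adjoint_matrix U0)"
      by (simp only: matrix_mul_assoc)
    then have U0_comm: "adjoint_matrix U0 ** T t $ i = T t $ i ** adjoint_matrix U0"
      by (simp add: U0_unitary)
    have "V s ** P s = T t $ i ** V s" for s
    proof -
      have "V s ** P s = adjoint_matrix U0 ** (T t $ i ** U (axis_rotation m s))"
        using U [OF axis_rotation_in_SO3] t
        by (simp add: V_def P_def compensates_iff matrix_mul_assoc [symmetric])
      then show ?thesis
        by (simp add: V_def matrix_mul_assoc U0_comm)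
    qed
    \<comment> \<open>The derivative at 0 is computed twice, from \<open>T t $ i ** V s\<close> and
      by the product rule; comparing the results gives the commutator.\<close>
    then have "((\<lambda>s. V s ** P s) has_vector_derivative T t $ i ** X) (at 0)"
      using bounded_linear.has_vector_derivative [OF mm.bounded_linear_right V] by simp
    moreover have "((\<lambda>s. V s ** P s) has_vector_derivative
        rotate_triple (axis_generator m) (T t) $ i + X ** T t $ i) (at 0)"
      using mm.has_vector_derivative [OF V P] by (simp add: V0 P_def axis_rotation_0)
    ultimately have "T t $ i ** X = rotate_triple (axis_generator m) (T t) $ i + X ** T t $ i"
      by (rule vector_derivative_unique_at)
    then show ?thesis
      by (simp add: commutator_def rotate_triple_axis_generator)
  qed
  then show ?thesis
    using that skew_minus_trace_in_su [OF skew] by (simp add: commutator_minus_mat)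
qed

theorem theorem4p1:
  fixes I :: "real set" and T :: "real \<Rightarrow> complex^'n^'n^3"
  assumes "open I" and "connected I" and "I \<noteq> {}"
    and "nahm_solution I T"
  shows "(spherically_symmetric I T \<and>
       (\<exists>U. (\<forall>A\<in>SO3. compensates I T A (U A)) \<and>
            continuously_differentiable_at_within U (mat 1) SO3) \<longrightarrow>
       (\<exists>Y :: complex^'n^'n^3. (\<forall>i. Y $ i \<in> su) \<and>
         (\<forall>t\<in>I. \<forall>i j. commutator (Y $ i) (T t $ j) =
             (\<Sum>k\<in>UNIV. levi_civita i j k *\<^sub>R T t $ k)))) \<and>
     ((\<exists>Y :: complex^'n^'n^3. (\<forall>i. Y $ i \<in> su) \<and>
         (\<forall>t\<in>I. \<forall>i j. commutator (Y $ i) (T t $ j) =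
             (\<Sum>k\<in>UNIV. levi_civita i j k *\<^sub>R T t $ k))) \<longrightarrow>
       spherically_symmetric I T)"
proof (intro conjI impI)
  assume "spherically_symmetric I T \<and>
       (\<exists>U. (\<forall>A\<in>SO3. compensates I T A (U A)) \<and>
            continuously_differentiable_at_within U (mat 1) SO3)"
  then obtain U where U: "\<And>A. A \<in> SO3 \<Longrightarrow> compensates I T A (U A)"
    and "continuously_differentiable_at_within U (mat 1) SO3"
    by blast
  moreover have "mat 1 \<in> SO3"
    using axis_rotation_in_SO3 [of 1 0] by (simp add: axis_rotation_0)
  \<comment> \<open>The identity lies in the neighbourhood on which the derivative is given.\<close>
  ultimately obtain D where D: "(U has_derivative D) (at (mat 1) within SO3)"
    unfolding continuously_differentiable_at_within_def by blast
  have "\<exists>Y. Y \<in> su \<and> (\<forall>t\<in>I. \<forall>i. commutator Y (T t $ i) =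
      (\<Sum>k\<in>UNIV. levi_civita m i k *\<^sub>R T t $ k))" for m
    using commutator_if_differentiable [OF U D, of m] by metis
  then obtain Y where "\<And>m. Y m \<in> su" "\<And>m t i. t \<in> I \<Longrightarrow>
      commutator (Y m) (T t $ i) = (\<Sum>k\<in>UNIV. levi_civita m i k *\<^sub>R T t $ k)"
    by metis
  then show "\<exists>Y :: complex^'n^'n^3. (\<forall>i. Y $ i \<in> su) \<and>
         (\<forall>t\<in>I. \<forall>i j. commutator (Y $ i) (T t $ j) =
             (\<Sum>k\<in>UNIV. levi_civita i j k *\<^sub>R T t $ k))"
    by (intro exI [of _ "\<chi> m. Y m"]) simp
next
  assume "\<exists>Y :: complex^'n^'n^3. (\<forall>i. Y $ i \<in> su) \<and>
         (\<forall>t\<in>I. \<forall>i j. commutator (Y $ i) (T t $ j) =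
             (\<Sum>k\<in>UNIV. levi_civita i j k *\<^sub>R T t $ k))"
  then show "spherically_symmetric I T"
    using spherically_symmetric_if_commutators by blast
qed

end
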